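(* For any connected graph $G$ of order $n\ge 2$, $\gamma_{tc}(M(G\circ K_1))=2n$.
   Context: All graphs are finite, simple and undirected. The corona $G\circ K_1$ is the graph of order $2|V(G)|$ obtained from $G$ by attaching a new pendant vertex (by a pendant edge) to each vertex of $G$. For a graph $H$, a set $D\subseteq V(H)$ is a total dominating set if every vertex of $H$ has a neighbor in $D$. A set $D\subseteq V(H)$ is a total outer-connected dominating set of $H$ if $D$ is a total dominating set and the induced subgraph $H[V(H)\setminus D]$ is connected; $\gamma_{tc}(H)$ denotes the minimum cardinality of a total outer-connected dominating set of $H$. The middle graph $M(G)$ of a graph $G$ has vertex set $V(G)\cup E(G)$, where two elements $x,y$ are adjacent iff either $x,y\in E(G)$ are edges of $G$ sharing an endpoint, or one of them is a vertex of $G$ and the other is an edge of $G$ incident to it. *)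

theory Defs
  imports "Graph_Theory.Digraph_Component"
begin

text \<open>
  Finite simple undirected graphs are represented by the locale \<^locale>\<open>pair_graph\<close>: a finite
  loop-free digraph with symmetric arc relation, so each edge \<open>uv\<close> appears as the two arcs
  \<open>(u,v)\<close> and \<open>(v,u)\<close>.
\<close>

definition undirected_edges :: "'a pair_pre_digraph \<Rightarrow> 'a set set" where
  "undirected_edges G = {{u, v} | u v. (u, v) \<in> parcs G}"

text \<open>\<^term>\<open>Inl v\<close> is the original vertex \<open>v\<close>, and \<^term>\<open>Inr v\<close> the pendant vertex attached to it.\<close>

definition corona_K1 :: "'a pair_pre_digraph \<Rightarrow> ('a + 'a) pair_pre_digraph" where
  "corona_K1 G = \<lparr>
     pverts = Inl ` pverts G \<union> Inr ` pverts G,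
     parcs = {(Inl u, Inl v) | u v. (u, v) \<in> parcs G}
           \<union> {(Inl v, Inr v) | v. v \<in> pverts G}
           \<union> {(Inr v, Inl v) | v. v \<in> pverts G} \<rparr>"

definition middle_graph :: "'a pair_pre_digraph \<Rightarrow> ('a + 'a set) pair_pre_digraph" where
  "middle_graph G = \<lparr>
     pverts = Inl ` pverts G \<union> Inr ` undirected_edges G,
     parcs = {(Inr e, Inr f) | e f. e \<in> undirected_edges G \<and> f \<in> undirected_edges G
                                  \<and> e \<noteq> f \<and> e \<inter> f \<noteq> {}}
           \<union> {(Inl v, Inr e) | v e. v \<in> pverts G \<and> e \<in> undirected_edges G \<and> v \<in> e}
           \<union> {(Inr e, Inl v) | v e. v \<in> pverts G \<and> e \<in> undirected_edges G \<and> v \<in> e} \<rparr>"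

definition total_dominating_set :: "'a pair_pre_digraph \<Rightarrow> 'a set \<Rightarrow> bool" where
  "total_dominating_set H D \<longleftrightarrow>
     D \<subseteq> pverts H \<and> (\<forall>v \<in> pverts H. \<exists>u \<in> D. (v, u) \<in> parcs H)"

text \<open>The library's notion of connectedness excludes the graph without vertices, so the whole
  vertex set does not count as a total outer-connected dominating set.\<close>

definition total_outer_connected_dominating_set :: "'a pair_pre_digraph \<Rightarrow> 'a set \<Rightarrow> bool" where
  "total_outer_connected_dominating_set H D \<longleftrightarrow>
     total_dominating_set H D \<and>
     Digraph_Component.connected (with_proj H \<restriction> (pverts H - D))"

definition gamma_tc :: "'a pair_pre_digraph \<Rightarrow> nat" where
  "gamma_tc H = (LEAST k. \<exists>D. total_outer_connected_dominating_set H D \<and> card D = k)"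

lemma pair_graph_corona_K1:
  assumes "pair_graph G"
  shows "pair_graph (corona_K1 G)"
proof -
  interpret pair_graph G by fact
  have "parcs (corona_K1 G) \<subseteq> pverts (corona_K1 G) \<times> pverts (corona_K1 G)"
    by (auto simp: corona_K1_def dest: in_arcsD1 in_arcsD2)
  moreover have "finite (pverts (corona_K1 G))"
    by (simp add: corona_K1_def)
  ultimately have "finite (parcs (corona_K1 G))"
    by (meson finite_SigmaI finite_subset)
  then show ?thesis
    by unfold_locales
      (auto simp: corona_K1_def symmetric_def sym_def
            dest: in_arcsD1 in_arcsD2 no_loops' arcs_symmetric)
qed

lemma card_corona_K1:
  assumes "finite (pverts G)"
  shows "card (pverts (corona_K1 G)) = 2 * card (pverts G)"
proof -
  have "card (Inl ` pverts G \<union> Inr ` pverts G) = card (pverts G) + card (pverts G)"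
    using assms by (subst card_Un_disjoint) (auto simp: card_image)
  then show ?thesis by (simp add: corona_K1_def)
qed

lemma pair_graph_middle_graph:
  assumes "pair_graph G"
  shows "pair_graph (middle_graph G)"
proof -
  interpret pair_graph G by fact
  have "undirected_edges G = (\<lambda>(u, v). {u, v}) ` parcs G"
    by (auto simp: undirected_edges_def)
  then have fin: "finite (pverts (middle_graph G))"
    by (simp add: middle_graph_def)
  have "parcs (middle_graph G) \<subseteq> pverts (middle_graph G) \<times> pverts (middle_graph G)"
    by (auto simp: middle_graph_def)
  with fin have "finite (parcs (middle_graph G))"
    by (meson finite_SigmaI finite_subset)
  with fin show ?thesis
    by unfold_locales (auto simp: middle_graph_def symmetric_def sym_def)
qed

end

theory Submission
  imports Defs
begin

text \<open>
  In \<open>M(G \<circ> K\<^sub>1)\<close> the only neighbour of a pendant vertex is its pendant edge, so every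
  total dominating set contains all \<open>n\<close> pendant edges. A pendant vertex outside the set is then
  isolated in the complement; hence either all \<open>n\<close> pendant vertices lie in the set, or the
  complement is a single pendant vertex and the set contains the \<open>n\<close> original vertices. Conversely,
  the pendant vertices together with the pendant edges totally dominate, and their complement
  is \<open>M(G)\<close>, which is connected.
\<close>

section \<open>Connectedness as reachability\<close>

lemma connected_induce_subgraph_iff:
  assumes "pair_graph H" and "S \<subseteq> pverts H"
  shows "Digraph_Component.connected (with_proj H \<restriction> S) \<longleftrightarrow>
    S \<noteq> {} \<and> (\<forall>u \<in> S. \<forall>v \<in> S. (u, v) \<in> (Restr (parcs H) S)\<^sup>*)"
proof -
  interpret pair_graph H by fact
  let ?M = "mk_symmetric (with_proj H \<restriction> S)"
  interpret M: pair_wf_digraph ?M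
    by (rule wf_digraph.wellformed_mk_symmetric) (rule wellformed_induce_subgraph)
  \<comment> \<open>The arc relation is symmetric, so symmetrising the induced subgraph adds no
    arcs, and connectedness is reachability inside \<open>S\<close>.\<close>
  have "parcs ?M = Restr (parcs H) S"
    by (auto simp: parcs_mk_symmetric dest: arcs_symmetric)
  then show ?thesis
    by (auto simp: connected_def strongly_connected_def M.reachable_conv)
qed

lemma connected_with_proj_iff:
  assumes "pair_graph G"
  shows "Digraph_Component.connected (with_proj G) \<longleftrightarrow>
    pverts G \<noteq> {} \<and> (\<forall>u \<in> pverts G. \<forall>v \<in> pverts G. (u, v) \<in> (parcs G)\<^sup>*)"
proof -
  interpret pair_graph G by fact
  have "with_proj G \<restriction> pverts G = with_proj G"
    by (auto simp: induce_subgraph_def with_proj_def dest: in_arcsD1 in_arcsD2)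
  moreover have "Restr (parcs G) (pverts G) = parcs G"
    by (auto dest: in_arcsD1 in_arcsD2)
  ultimately show ?thesis
    using connected_induce_subgraph_iff[OF assms order_refl] by simp
qed

text \<open>A walk inside \<open>S\<close> from \<open>x\<close> to a different vertex would have to
  start with an arc from \<open>x\<close> into \<open>S\<close>.\<close>

lemma isolated_vertex_connected_induce_subgraph:
  assumes "pair_graph H" and "S \<subseteq> pverts H"
    and "Digraph_Component.connected (with_proj H \<restriction> S)"
    and "x \<in> S" and "\<And>y. y \<in> S \<Longrightarrow> (x, y) \<notin> parcs H"
  shows "S = {x}"
proof -
  have "y = x" if "y \<in> S" for y
  proof -
    have "(x, y) \<in> (Restr (parcs H) S)\<^sup>*"
      using assms that by (simp add: connected_induce_subgraph_iff)
    then show ?thesis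
      using assms(5) by (cases rule: converse_rtranclE) auto
  qed
  with assms(4) show ?thesis by blast
qed

section \<open>The middle graph of the corona\<close>

lemma pverts_corona_K1 [simp]: "pverts (corona_K1 G) = Inl ` pverts G \<union> Inr ` pverts G"
  by (simp add: corona_K1_def)

lemma pverts_middle_graph [simp]:
  "pverts (middle_graph G) = Inl ` pverts G \<union> Inr ` undirected_edges G"
  by (simp add: middle_graph_def)

lemma parcs_middle_graph_iffs [simp]:
  "(Inl v, Inl w) \<notin> parcs (middle_graph G)"
  "(Inl v, Inr e) \<in> parcs (middle_graph G) \<longleftrightarrow> v \<in> pverts G \<and> e \<in> undirected_edges G \<and> v \<in> e"
  "(Inr e, Inl v) \<in> parcs (middle_graph G) \<longleftrightarrow> v \<in> pverts G \<and> e \<in> undirected_edges G \<and> v \<in> e"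
  "(Inr e, Inr f) \<in> parcs (middle_graph G) \<longleftrightarrow>
    e \<in> undirected_edges G \<and> f \<in> undirected_edges G \<and> e \<noteq> f \<and> e \<inter> f \<noteq> {}"
  by (auto simp: middle_graph_def)

definition pendant_edge :: "'a \<Rightarrow> ('a + 'a) set" where
  "pendant_edge v = {Inl v, Inr v}"

lemma inj_pendant_edge: "inj pendant_edge"
  by (auto simp: inj_def pendant_edge_def doubleton_eq_iff)

lemma undirected_edges_corona_K1:
  "undirected_edges (corona_K1 G) = (`) Inl ` undirected_edges G \<union> pendant_edge ` pverts G"
proof (intro equalityI subsetI)
  fix e assume "e \<in> undirected_edges (corona_K1 G)"
  then consider u v where "e = {Inl u, Inl v}" "(u, v) \<in> parcs G"
    | v where "e = {Inl v, Inr v}" "v \<in> pverts G"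
    unfolding undirected_edges_def corona_K1_def by fastforce
  then show "e \<in> (`) Inl ` undirected_edges G \<union> pendant_edge ` pverts G"
  proof cases
    case 1
    then have "e = Inl ` {u, v}" "{u, v} \<in> undirected_edges G"
      by (auto simp: undirected_edges_def)
    then show ?thesis by blast
  qed (auto simp: pendant_edge_def)
next
  fix e assume "e \<in> (`) Inl ` undirected_edges G \<union> pendant_edge ` pverts G"
  then show "e \<in> undirected_edges (corona_K1 G)"
  proof
    assume "e \<in> (`) Inl ` undirected_edges G"
    then obtain u v where "e = {Inl u, Inl v}" "(u, v) \<in> parcs G"
      by (auto simp: undirected_edges_def)
    moreover from this have "(Inl u, Inl v) \<in> parcs (corona_K1 G)"
      by (simp add: corona_K1_def)
    ultimately show ?thesis unfolding undirected_edges_def by blast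
  qed (auto simp: undirected_edges_def corona_K1_def pendant_edge_def)
qed

text \<open>This set will attain the minimum. The outer constructor separates vertices
  (\<open>Inl\<close>) from edges (\<open>Inr\<close>) of the corona; the inner \<open>Inr\<close>
  marks pendant vertices.\<close>

definition pendant_set :: "'a pair_pre_digraph \<Rightarrow> (('a + 'a) + ('a + 'a) set) set" where
  "pendant_set G = (Inl \<circ> Inr) ` pverts G \<union> (Inr \<circ> pendant_edge) ` pverts G"

text \<open>The map \<open>f\<close> is left open because both cases of the lower bound need the
  count: \<open>Inr\<close> gives the pendant vertices, \<open>Inl\<close> the original
  ones.\<close>

lemma card_Inl_Un_pendant_edges:
  fixes A :: "'a set" and f :: "'a \<Rightarrow> 'b"
  assumes "finite A" and "inj f"
  shows "card ((Inl \<circ> f) ` A \<union> (Inr \<circ> pendant_edge) ` A) = 2 * card A"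
proof -
  have "inj_on (Inl \<circ> f :: 'a \<Rightarrow> 'b + ('a + 'a) set) A"
    "inj_on (Inr \<circ> pendant_edge :: 'a \<Rightarrow> 'b + ('a + 'a) set) A"
    by (auto intro!: inj_onI dest: injD[OF assms(2)] injD[OF inj_pendant_edge])
  with assms(1) show ?thesis
    by (subst card_Un_disjoint) (simp_all only: card_image finite_imageI, auto)
qed

lemma card_pendant_set:
  assumes "finite (pverts G)"
  shows "card (pendant_set G) = 2 * card (pverts G)"
  using assms by (simp only: pendant_set_def card_Inl_Un_pendant_edges inj_Inr)

section \<open>Lower bound\<close>

lemma pendant_vertex_neighbour:
  assumes "(Inl (Inr v), y) \<in> parcs (middle_graph (corona_K1 G))"
  shows "y = Inr (pendant_edge v)"
  \<comment> \<open>Copies of edges of \<open>G\<close> contain only \<open>Inl\<close> elements, so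
    \<open>Inr v\<close> lies on its pendant edge alone.\<close>
  using assms
  by (cases y) (auto simp: undirected_edges_corona_K1 pendant_edge_def)

lemma total_dominating_set_contains_pendant_edges:
  assumes "total_dominating_set (middle_graph (corona_K1 G)) D" and "v \<in> pverts G"
  shows "Inr (pendant_edge v) \<in> D"
proof -
  have "Inl (Inr v) \<in> pverts (middle_graph (corona_K1 G))"
    using assms(2) by auto
  with assms(1) obtain u where "u \<in> D" "(Inl (Inr v), u) \<in> parcs (middle_graph (corona_K1 G))"
    unfolding total_dominating_set_def by blast
  then show ?thesis using pendant_vertex_neighbour by metis
qed

lemma card_total_outer_connected_dominating_set_ge:
  assumes "pair_graph G"
    and D: "total_outer_connected_dominating_set (middle_graph (corona_K1 G)) D"
  shows "2 * card (pverts G) \<le> card D"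
proof -
  interpret pair_graph G by fact
  let ?M = "middle_graph (corona_K1 G)"
  have M: "pair_graph ?M"
    using assms(1) by (intro pair_graph_middle_graph pair_graph_corona_K1)
  have tds: "total_dominating_set ?M D"
    and conn: "Digraph_Component.connected (with_proj ?M \<restriction> (pverts ?M - D))"
    using D by (auto simp: total_outer_connected_dominating_set_def)
  have "D \<subseteq> pverts ?M"
    using tds by (simp add: total_dominating_set_def)
  moreover have "finite (pverts ?M)"
  proof -
    interpret M: pair_graph ?M by fact
    show ?thesis using M.finite_verts by (simp only: with_proj_simps)
  qed
  ultimately have fin: "finite D" by (rule finite_subset)
  have edges: "Inr (pendant_edge v) \<in> D" if "v \<in> pverts G" for v
    using tds that by (rule total_dominating_set_contains_pendant_edges)
  show ?thesis
  proof (cases "(Inl \<circ> Inr) ` pverts G \<subseteq> D")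
    case True
    then have "pendant_set G \<subseteq> D"
      using edges by (auto simp: pendant_set_def)
    then have "card (pendant_set G) \<le> card D"
      using fin by (rule card_mono[rotated])
    then show ?thesis by (simp add: card_pendant_set)
  next
    case False
    then obtain w where w: "w \<in> pverts G" "Inl (Inr w) \<notin> D" by auto
    \<comment> \<open>The only neighbour of the pendant vertex at \<open>w\<close> is its pendant
      edge, which lies in \<open>D\<close>. The vertex is thus isolated in the complement, and
      connectedness leaves room for nothing else there.\<close>
    have compl: "pverts ?M - D = {Inl (Inr w)}"
    proof (rule isolated_vertex_connected_induce_subgraph[OF M _ conn])
      show "Inl (Inr w) \<in> pverts ?M - D"
        using w by auto
      show "(Inl (Inr w), y) \<notin> parcs ?M" if "y \<in> pverts ?M - D" for y
        using that edges[OF w(1)] by (auto dest: pendant_vertex_neighbour)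
    qed auto
    \<comment> \<open>Original vertices differ from the single missing vertex, so they replace the
      pendant vertices in the count.\<close>
    have "Inl (Inl v) \<in> D" if "v \<in> pverts G" for v
    proof -
      have "Inl (Inl v) \<in> pverts ?M"
        using that by auto
      with compl show ?thesis by blast
    qed
    with edges have "(Inl \<circ> Inl) ` pverts G \<union> (Inr \<circ> pendant_edge) ` pverts G \<subseteq> D"
      by auto
    from card_mono[OF fin this] show ?thesis
      using finite_verts by (simp only: card_Inl_Un_pendant_edges inj_Inl with_proj_simps)
  qed
qed

section \<open>Upper bound\<close>

lemma total_dominating_set_pendant_set:
  assumes "pair_graph G"
  shows "total_dominating_set (middle_graph (corona_K1 G)) (pendant_set G)"
  unfolding total_dominating_set_def
proof (intro conjI ballI)
  interpret pair_graph G by fact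
  let ?M = "middle_graph (corona_K1 G)"
  show "pendant_set G \<subseteq> pverts ?M"
    by (auto simp: pendant_set_def undirected_edges_corona_K1)
  fix x assume "x \<in> pverts ?M"
  then consider v where "v \<in> pverts G" "x = Inl (Inl v) \<or> x = Inl (Inr v)"
    | v where "v \<in> pverts G" "x = Inr (pendant_edge v)"
    | e where "e \<in> undirected_edges G" "x = Inr (Inl ` e)"
    by (auto simp: undirected_edges_corona_K1)
  \<comment> \<open>Original and pendant vertices are dominated by their pendant edge. Pendant edges
    are pairwise disjoint, so each needs its pendant vertex as dominator. An edge of
    \<open>G\<close> is dominated by the pendant edge at one of its endpoints.\<close>
  then show "\<exists>u \<in> pendant_set G. (x, u) \<in> parcs ?M"
  proof cases
    case (1 v)
    then have "(x, Inr (pendant_edge v)) \<in> parcs ?M"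
      by (auto simp: undirected_edges_corona_K1 pendant_edge_def)
    with 1 show ?thesis by (auto simp: pendant_set_def)
  next
    case (2 v)
    then have "(x, Inl (Inr v)) \<in> parcs ?M"
      by (auto simp: undirected_edges_corona_K1 pendant_edge_def)
    moreover have "Inl (Inr v) \<in> pendant_set G"
      using 2 by (auto simp: pendant_set_def)
    ultimately show ?thesis by blast
  next
    case (3 e)
    then obtain u v where uv: "e = {u, v}" "u \<in> pverts G"
      by (auto simp: undirected_edges_def dest: in_arcsD1)
    have "Inl ` e \<noteq> pendant_edge u" "Inl u \<in> Inl ` e \<inter> pendant_edge u"
      using uv by (auto simp: pendant_edge_def)
    then have "(x, Inr (pendant_edge u)) \<in> parcs ?M"
      using 3 uv(2) by (auto simp: undirected_edges_corona_K1)
    with uv(2) show ?thesis by (auto simp: pendant_set_def)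
  qed
qed

text \<open>The complement is a copy of the middle graph of \<open>G\<close>, so walks in
  \<open>G\<close> lift to it by passing through the edges they traverse.\<close>

lemma connected_induce_compl_pendant_set:
  assumes "pair_graph G" and "Digraph_Component.connected (with_proj G)"
  shows "Digraph_Component.connected (with_proj (middle_graph (corona_K1 G)) \<restriction>
    (pverts (middle_graph (corona_K1 G)) - pendant_set G))"
proof -
  interpret pair_graph G by fact
  let ?M = "middle_graph (corona_K1 G)"
  define S where "S = pverts ?M - pendant_set G"
  define R where "R = Restr (parcs ?M) S"
  have M: "pair_graph ?M"
    using assms(1) by (intro pair_graph_middle_graph pair_graph_corona_K1)
  have ne: "pverts G \<noteq> {}" and reach: "\<And>u v. u \<in> pverts G \<Longrightarrow> v \<in> pverts G \<Longrightarrow> (u, v) \<in> (parcs G)\<^sup>*"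
    using assms by (auto simp: connected_with_proj_iff)
  \<comment> \<open>A pendant edge contains an \<open>Inr\<close> element and a copied edge does
    not, so no copied edge is removed with the pendant set.\<close>
  have image_ne: "Inl ` e \<noteq> pendant_edge v" for e :: "'a set" and v
    by (auto simp: pendant_edge_def)
  have S_eq: "S = (Inl \<circ> Inl) ` pverts G \<union> (\<lambda>e. Inr (Inl ` e)) ` undirected_edges G"
    unfolding S_def
    by (auto simp: pendant_set_def undirected_edges_corona_K1 image_ne)
  have incident: "(Inl (Inl v), Inr (Inl ` e)) \<in> R \<and> (Inr (Inl ` e), Inl (Inl v)) \<in> R"
    if "v \<in> pverts G" "e \<in> undirected_edges G" "v \<in> e" for v e
    using that unfolding R_def S_eq
    by (auto simp: undirected_edges_corona_K1)
  \<comment> \<open>Each arc from \<open>y\<close> to \<open>z\<close> becomes the two steps from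
    \<open>y\<close> to the edge \<open>{y, z}\<close> and on to \<open>z\<close>.\<close>
  have verts: "(Inl (Inl u), Inl (Inl v)) \<in> R\<^sup>*" if "(u, v) \<in> (parcs G)\<^sup>*" for u v
    using that
  proof (induction rule: rtrancl_induct)
    case (step y z)
    have "{y, z} \<in> undirected_edges G" "y \<in> pverts G" "z \<in> pverts G"
      using step.hyps(2) by (auto simp: undirected_edges_def dest: in_arcsD1 in_arcsD2)
    then have "(Inl (Inl y), Inr (Inl ` {y, z})) \<in> R" "(Inr (Inl ` {y, z}), Inl (Inl z)) \<in> R"
      using incident[of y "{y, z}"] incident[of z "{y, z}"] by blast+
    with step.IH show ?case by (meson rtrancl.rtrancl_into_rtrancl)
  qed simp
  \<comment> \<open>An edge is tied to one of its endpoints, a vertex to itself. Both directions are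
    recorded so that any two elements can be joined through original vertices.\<close>
  have to_vert: "\<exists>v \<in> pverts G. (x, Inl (Inl v)) \<in> R\<^sup>* \<and> (Inl (Inl v), x) \<in> R\<^sup>*" if "x \<in> S" for x
    using that unfolding S_eq
  proof
    assume "x \<in> (\<lambda>e. Inr (Inl ` e)) ` undirected_edges G"
    then obtain e where e: "e \<in> undirected_edges G" "x = Inr (Inl ` e)" by blast
    then obtain v where "v \<in> e" "v \<in> pverts G"
      by (auto simp: undirected_edges_def dest: in_arcsD1)
    with e incident[of v e] show ?thesis by blast
  qed auto
  have "(x, y) \<in> R\<^sup>*" if "x \<in> S" "y \<in> S" for x y
  proof -
    obtain u v where "u \<in> pverts G" "v \<in> pverts G"
      "(x, Inl (Inl u)) \<in> R\<^sup>*" "(Inl (Inl v), y) \<in> R\<^sup>*"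
      using to_vert \<open>x \<in> S\<close> \<open>y \<in> S\<close> by meson
    with verts[OF reach] show ?thesis by (meson rtrancl_trans)
  qed
  moreover have "S \<noteq> {}" using ne by (auto simp: S_eq)
  moreover have "S \<subseteq> pverts ?M" by (auto simp: S_def)
  ultimately show ?thesis
    using connected_induce_subgraph_iff[OF M] unfolding R_def S_def by blast
qed

theorem theorem4p1:
  fixes G :: "'a pair_pre_digraph" and n :: nat
  assumes "pair_graph G"
    and "Digraph_Component.connected (with_proj G)"
    and "card (pverts G) = n"
    and "n \<ge> 2"
  shows "gamma_tc (middle_graph (corona_K1 G)) = 2 * n"
  unfolding gamma_tc_def
proof (rule Least_equality)
  interpret pair_graph G by fact
  have "total_outer_connected_dominating_set (middle_graph (corona_K1 G)) (pendant_set G)"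
    unfolding total_outer_connected_dominating_set_def
    using assms(1,2) total_dominating_set_pendant_set connected_induce_compl_pendant_set by blast
  moreover have "card (pendant_set G) = 2 * n"
    using assms(3) by (simp add: card_pendant_set)
  ultimately show "\<exists>D. total_outer_connected_dominating_set (middle_graph (corona_K1 G)) D
      \<and> card D = 2 * n"
    by blast
next
  fix k
  assume "\<exists>D. total_outer_connected_dominating_set (middle_graph (corona_K1 G)) D \<and> card D = k"
  then show "2 * n \<le> k"
    using card_total_outer_connected_dominating_set_ge[OF assms(1)] assms(3) by blast
qed

end
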